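(* Let $r\ge2$ and let $H$ be an $r$-graph. There is a constant $C(H)$ depending only on $H$ such that the following holds. Let $p\in(0,1)$ and $n\in\mathbb N$. Let $\mathbb B=\{\mathsf B(e)\}_{e\in E(H)}$ be an $H$-dominating base system with weights $$\mathsf B(e)=\big(r,e,\iota_e,\mathsf F(e),d^H(e),\{d^H_{\mathsf f}(e)\}_{\mathsf f\in\mathsf F(e)}\big),$$ and let $\|\cdot\|_{\mathbb B}^*$ be the associated seminorm. Let $\mathcal C\subset\mathcal A_{n,r}$ be a set of diameter at most $\varepsilon p$ under $\|\cdot\|^*_{\mathbb B}$ for some $\varepsilon\in(0,1]$, and assume there exist $Q_0\in\mathrm{hull}(\mathcal C)$ and $L\ge1$ such that $$t_p(H',Q_0)\le L$$ for all proper subgraphs $H'\subset H$. Then for any $\underline P=\{P^e\}_{e\in E(H)}$ and $\underline Q=\{Q^e\}_{e\in E(H)}$ with each $P^e,Q^e\in\mathrm{hull}(\mathcal C)$, $$\big|t_p(H,\underline P)-t_p(H,\underline Q)\big|\le C(H)\,L\varepsilon.$$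
   Context: **Hypergraphs and tensors.** An $r$-graph is a finite simple $r$-uniform hypergraph $H$ with vertex set $V(H)$, edge set $E(H)$, $v(H)=|V(H)|$, $e(H)=|E(H)|$. $H'\subset H$ (proper subgraph) means $V(H')\subseteq V(H)$ and $E(H')\subsetneq E(H)$. $\mathcal S_{n,r}$ is the set of symmetric functions $[n]^r\to\mathbb R$ vanishing whenever the coordinates are not all distinct; $\mathcal A_{n,r}\subset\mathcal S_{n,r}$ is the subset of $\{0,1\}$-valued ones. $\mathrm{hull}$ denotes convex hull, $\langle\cdot,\cdot\rangle$ the Euclidean inner product of $r$-tensors $[n]^r\to\mathbb R$. **Homomorphism densities.** For $\underline S=\{S^e\}_{e\in E(H)}$ in $\mathcal S_{n,r}$, $$t_p(H,\underline S)=\frac1{n^{v(H)}p^{e(H)}}\sum_{\phi:V(H)\to[n]}\prod_{e\in E(H)}S^e(\phi(e)),$$ with $S(\phi(e))=S(\phi(v_1),\dots,\phi(v_r))$ for $e=\{v_1,\dots,v_r\}$; $t_p(H,S)$ is the case $S^e\equiv S$. **Degrees.** For $e\in E(H)$: $d^H(e)=|\{e'\in E(H):e'\ne e,\ e'\cap e\ne\emptyset\}|$; for nonempty $\mathsf f\subsetneq e$, $d_{\mathsf f}^H(e)=|\{e'\in E(H):\emptyset\ne e'\cap e\subseteq\mathsf f\}|$; $d^H_\emptyset(e)=0$. **Base systems.** Given a set $e$ of size $r$, a base over $e$ is a collection $\mathsf F$ of proper subsets of $e$ with $\emptyset\in\mathsf F$ such that no nonempty element of $\mathsf F$ is strictly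 contained in another. A weighted base over $e$ is a tuple $\mathsf B=(r,e,\iota,\mathsf F,d_\star,\{d_{\mathsf f}\}_{\mathsf f\in\mathsf F})$ with $\iota:[r]\to e$ a bijection, $\mathsf F$ a base over $e$, non-negative integers $d_{\mathsf f}\le d_\star$, and $d_\emptyset=0$. A base system over $H$ is a collection $\{\mathsf B(e)\}_{e\in E(H)}$ with $\mathsf B(e)$ a weighted base over $e$. It is $H$-dominating if for every $e\in E(H)$ and every $e'\in E(H)$ with $e'\neq e$, $e\cap e'$ is contained in some element of the base $\mathsf F(e)$. **Norms** (depending on $n,p$). For a weighted base $\mathsf B$, $\mathcal T_{\mathsf B}$ is the set of nonzero $T:[n]^r\to\{0,1\}$ of the form $T=\prod_{\mathsf f\in\mathsf F}\tau_{\mathsf f}\circ\pi_{\mathsf f}$, with $\tau_{\mathsf f}:[n]^{\mathsf f}\to\{0,1\}$ arbitrary, $\tau_\emptyset\equiv1$, $\pi_{\mathsf f}(i_1,\dots,i_r)=(i_v)_{v\in\iota^{-1}(\mathsf f)}$ (each $T$ is understood with a choice of factors). With $\|\tau_{\mathsf f}\|_1$ the sum of entries of $\tau_{\mathsf f}$, set $\|T\|_{\mathsf f}=n^{r-|\mathsf f|}p^{d_\star-d_{\mathsf f}}\|\tau_{\mathsf f}\|_1$ (so $\|T\|_\emptyset=n^rp^{d_\star}$), $\|T\|_{\mathsf B}=\max\{\|T\|_1,\max_{\mathsf f\in\mathsf F}\|T\|_{\mathsf f}\}$, $\|Z\|^*_{\mathsf B}=\max_{T\in\mathcal T_{\mathsf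 B}}|\langle Z,T\rangle|/\|T\|_{\mathsf B}$, and $\|Z\|^*_{\mathbb B}=\max_{e\in E(H)}\|Z\|^*_{\mathsf B(e)}$. Diameter at most $\varepsilon p$ means $\|A-B\|^*_{\mathbb B}\le\varepsilon p$ for all $A,B\in\mathcal C$. *)

theory Defs
  imports
    "HOL-Analysis.Analysis"
    "HOL-Library.Function_Algebras"
    "HOL-Combinatorics.Permutations"
begin

text \<open>Pointwise vector space structure on real-valued functions, so that the library's
  \<open>convex hull\<close> applies to tensors.\<close>

instantiation "fun" :: (type, real_vector) real_vector
begin

definition scaleR_fun :: "real \<Rightarrow> ('a \<Rightarrow> 'b) \<Rightarrow> 'a \<Rightarrow> 'b" where
  "scaleR_fun c f = (\<lambda>x. c *\<^sub>R f x)"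

instance
  by standard (auto simp: scaleR_fun_def fun_eq_iff scaleR_add_right scaleR_add_left)

end


section \<open>Hypergraphs\<close>

definition uniform_hypergraph :: "nat \<Rightarrow> 'v set \<Rightarrow> 'v set set \<Rightarrow> bool" where
  "uniform_hypergraph r V E \<longleftrightarrow> finite V \<and> (\<forall>e\<in>E. e \<subseteq> V \<and> card e = r)"

definition proper_subgraph ::
    "nat \<Rightarrow> 'v set \<Rightarrow> 'v set set \<Rightarrow> 'v set \<Rightarrow> 'v set set \<Rightarrow> bool" where
  "proper_subgraph r V' E' V E \<longleftrightarrow> uniform_hypergraph r V' E' \<and> V' \<subseteq> V \<and> E' \<subset> E"

definition edge_degree :: "'v set set \<Rightarrow> 'v set \<Rightarrow> nat" where
  "edge_degree E e = card {e' \<in> E. e' \<noteq> e \<and> e' \<inter> e \<noteq> {}}"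

text \<open>For \<open>f = {}\<close> the set below is empty, which gives the convention that this degree is 0.\<close>

definition edge_subdegree :: "'v set set \<Rightarrow> 'v set \<Rightarrow> 'v set \<Rightarrow> nat" where
  "edge_subdegree E e f = card {e' \<in> E. e' \<inter> e \<noteq> {} \<and> e' \<inter> e \<subseteq> f}"


section \<open>Tensors and homomorphism densities\<close>

text \<open>\<open>[n]\<close> is \<open>{1..n}\<close>, and \<open>[n]\<^sup>A\<close> is the set \<open>A \<rightarrow>\<^sub>E {1..n}\<close> of extensional functions; in
  particular \<open>[n]\<^sup>r\<close> is \<open>{1..r} \<rightarrow>\<^sub>E {1..n}\<close>. A tensor \<open>[n]\<^sup>r \<rightarrow> \<real>\<close> is a total function on
  \<open>nat \<Rightarrow> nat\<close>; the tensors in the sets below are 0 outside \<open>[n]\<^sup>r\<close>, so that each one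
  has a unique representation.\<close>

type_synonym tensor = "(nat \<Rightarrow> nat) \<Rightarrow> real"

abbreviation index_tuples :: "nat \<Rightarrow> nat \<Rightarrow> (nat \<Rightarrow> nat) set" where
  "index_tuples n r \<equiv> {1..r} \<rightarrow>\<^sub>E {1..n}"

definition symmetric_tensors :: "nat \<Rightarrow> nat \<Rightarrow> tensor set" where
  "symmetric_tensors n r = {S.
     (\<forall>i. i \<notin> index_tuples n r \<longrightarrow> S i = 0) \<and>
     (\<forall>\<sigma>. \<sigma> permutes {1..r} \<longrightarrow> (\<forall>i\<in>index_tuples n r. S (i \<circ> \<sigma>) = S i)) \<and>
     (\<forall>i\<in>index_tuples n r. \<not> inj_on i {1..r} \<longrightarrow> S i = 0)}"

definition adjacency_tensors :: "nat \<Rightarrow> nat \<Rightarrow> tensor set" where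
  "adjacency_tensors n r = {S \<in> symmetric_tensors n r. \<forall>i\<in>index_tuples n r. S i \<in> {0, 1}}"

text \<open>The tuple \<open>(\<phi>(v\<^sub>1), \<dots>, \<phi>(v\<^sub>r))\<close> for an edge \<open>e = {v\<^sub>1, \<dots>, v\<^sub>r}\<close>. The enumeration of \<open>e\<close> is
  arbitrary; the value of a symmetric tensor at the tuple does not depend on it.\<close>

definition edge_tuple :: "nat \<Rightarrow> ('v \<Rightarrow> nat) \<Rightarrow> 'v set \<Rightarrow> nat \<Rightarrow> nat" where
  "edge_tuple r \<phi> e = (\<lambda>k\<in>{1..r}. \<phi> ((SOME \<nu>. bij_betw \<nu> {1..r} e) k))"

definition hom_density ::
    "nat \<Rightarrow> nat \<Rightarrow> real \<Rightarrow> 'v set \<Rightarrow> 'v set set \<Rightarrow> ('v set \<Rightarrow> tensor) \<Rightarrow> real" where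
  "hom_density r n p V E S =
     1 / (real n ^ card V * p ^ card E) *
     (\<Sum>\<phi> \<in> V \<rightarrow>\<^sub>E {1..n}. \<Prod>e\<in>E. S e (edge_tuple r \<phi> e))"

definition tensor_inner :: "nat \<Rightarrow> nat \<Rightarrow> tensor \<Rightarrow> tensor \<Rightarrow> real" where
  "tensor_inner n r Z T = (\<Sum>i\<in>index_tuples n r. Z i * T i)"


section \<open>Base systems\<close>

definition is_base :: "'v set \<Rightarrow> 'v set set \<Rightarrow> bool" where
  "is_base e F \<longleftrightarrow> (\<forall>f\<in>F. f \<subset> e) \<and> {} \<in> F \<and> (\<forall>f\<in>F. \<forall>g\<in>F. f \<noteq> {} \<longrightarrow> \<not> f \<subset> g)"

text \<open>The tuple \<open>(r, e, \<iota>, F, d\<^sub>\<star>, {d\<^sub>f})\<close>. Only the values of \<open>labelling\<close> on \<open>{1..r}\<close> and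
  of \<open>subdeg\<close> on \<open>base\<close> are meaningful.\<close>

record 'v weighted_base =
  uniformity :: nat
  ground :: "'v set"
  labelling :: "nat \<Rightarrow> 'v"
  base :: "'v set set"
  topdeg :: nat
  subdeg :: "'v set \<Rightarrow> nat"

definition is_weighted_base :: "'v weighted_base \<Rightarrow> bool" where
  "is_weighted_base B \<longleftrightarrow>
     finite (ground B) \<and> card (ground B) = uniformity B \<and>
     bij_betw (labelling B) {1..uniformity B} (ground B) \<and>
     is_base (ground B) (base B) \<and>
     (\<forall>f\<in>base B. subdeg B f \<le> topdeg B) \<and>
     subdeg B {} = 0"

definition is_base_system ::
    "nat \<Rightarrow> 'v set set \<Rightarrow> ('v set \<Rightarrow> 'v weighted_base) \<Rightarrow> bool" where
  "is_base_system r E BB \<longleftrightarrow>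
     (\<forall>e\<in>E. is_weighted_base (BB e) \<and> uniformity (BB e) = r \<and> ground (BB e) = e)"

definition dominating :: "'v set set \<Rightarrow> ('v set \<Rightarrow> 'v weighted_base) \<Rightarrow> bool" where
  "dominating E BB \<longleftrightarrow>
     (\<forall>e\<in>E. \<forall>e'\<in>E. e' \<noteq> e \<longrightarrow> (\<exists>f\<in>base (BB e). e \<inter> e' \<subseteq> f))"


section \<open>The norms\<close>

text \<open>The projection \<open>\<pi>\<^sub>f\<close>, with the coordinates in \<open>\<iota>\<^sup>-\<^sup>1(f)\<close> relabelled by \<open>\<iota>\<close> so that it
  lands in \<open>[n]\<^sup>f\<close>.\<close>

definition proj :: "'v weighted_base \<Rightarrow> 'v set \<Rightarrow> (nat \<Rightarrow> nat) \<Rightarrow> 'v \<Rightarrow> nat" where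
  "proj B f i = (\<lambda>v\<in>f. i (inv_into {1..uniformity B} (labelling B) v))"

text \<open>A test tensor is represented by its choice of factors \<open>\<tau>\<close>, since the norm of \<open>T\<close> is a function
  of the factors. Extensionality makes the set of choices finite, so the maxima
  below are maxima of finite sets.\<close>

definition factor_tensor ::
    "'v weighted_base \<Rightarrow> ('v set \<Rightarrow> ('v \<Rightarrow> nat) \<Rightarrow> real) \<Rightarrow> tensor" where
  "factor_tensor B \<tau> = (\<lambda>i. \<Prod>f\<in>base B. \<tau> f (proj B f i))"

definition test_factors ::
    "nat \<Rightarrow> 'v weighted_base \<Rightarrow> ('v set \<Rightarrow> ('v \<Rightarrow> nat) \<Rightarrow> real) set" where
  "test_factors n B =
     {\<tau> \<in> (\<Pi>\<^sub>E f\<in>base B. (f \<rightarrow>\<^sub>E {1..n}) \<rightarrow>\<^sub>E {0, 1}).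
        (\<forall>x \<in> {} \<rightarrow>\<^sub>E {1..n}. \<tau> {} x = 1) \<and>
        (\<exists>i\<in>index_tuples n (uniformity B). factor_tensor B \<tau> i \<noteq> 0)}"

definition norm1 :: "nat \<Rightarrow> 'v weighted_base \<Rightarrow> ('v set \<Rightarrow> ('v \<Rightarrow> nat) \<Rightarrow> real) \<Rightarrow> real" where
  "norm1 n B \<tau> = (\<Sum>i\<in>index_tuples n (uniformity B). factor_tensor B \<tau> i)"

definition face_norm ::
    "nat \<Rightarrow> real \<Rightarrow> 'v weighted_base \<Rightarrow> ('v set \<Rightarrow> ('v \<Rightarrow> nat) \<Rightarrow> real) \<Rightarrow> 'v set \<Rightarrow> real" where
  "face_norm n p B \<tau> f =
     real n ^ (uniformity B - card f) * p ^ (topdeg B - subdeg B f) *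
     (\<Sum>x \<in> f \<rightarrow>\<^sub>E {1..n}. \<tau> f x)"

definition test_norm ::
    "nat \<Rightarrow> real \<Rightarrow> 'v weighted_base \<Rightarrow> ('v set \<Rightarrow> ('v \<Rightarrow> nat) \<Rightarrow> real) \<Rightarrow> real" where
  "test_norm n p B \<tau> = max (norm1 n B \<tau>) (MAX f\<in>base B. face_norm n p B \<tau> f)"

definition base_norm :: "nat \<Rightarrow> real \<Rightarrow> 'v weighted_base \<Rightarrow> tensor \<Rightarrow> real" where
  "base_norm n p B Z =
     (MAX \<tau>\<in>test_factors n B.
        \<bar>tensor_inner n (uniformity B) Z (factor_tensor B \<tau>)\<bar> / test_norm n p B \<tau>)"

definition system_norm ::
    "nat \<Rightarrow> real \<Rightarrow> 'v set set \<Rightarrow> ('v set \<Rightarrow> 'v weighted_base) \<Rightarrow> tensor \<Rightarrow> real" where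
  "system_norm n p E BB Z = (MAX e\<in>E. base_norm n p (BB e) Z)"

end

theory Submission
  imports Defs
begin

text \<open>Homomorphism densities are affine in each tensor, so all tensors may be taken from \<open>\<C>\<close>, hence
  with values in \<open>{0, 1}\<close>, and changed one edge \<open>e\<close> at a time. Fix the part \<open>y\<close> of \<open>\<phi>\<close> outside
  \<open>e\<close>. As a function on \<open>[n]\<^sup>e\<close>, the product over the other edges is then a test tensor: the
  factor at \<open>f\<close> collects all edges that meet \<open>e\<close> inside \<open>f\<close>. Domination ensures that no edge is
  missed, and an edge counted in several factors does no harm because its values are idempotent.
  Summed over \<open>y\<close>, the norms of these test tensors become densities of the proper subgraphs consisting of
  the edges \<open>e' \<noteq> e\<close> with \<open>e \<inter> e' \<subseteq> f\<close>. Only the densities of \<open>Q0\<close> are bounded a priori; the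
  same estimate, used inductively on subgraphs, transfers the bound to all tensors in \<open>\<C>\<close>.\<close>

section \<open>Sums over function spaces and products of 0/1 values\<close>

lemma sum_PiE_Un:
  assumes "A \<inter> B = {}"
  shows "(\<Sum>\<phi>\<in>A \<union> B \<rightarrow>\<^sub>E X. g \<phi>)
       = (\<Sum>y\<in>A \<rightarrow>\<^sub>E X. \<Sum>x\<in>B \<rightarrow>\<^sub>E X. g (override_on y x B))"
  unfolding sum.cartesian_product
proof (rule sum.reindex_bij_witness[where i = "\<lambda>(y, x). override_on y x B"
      and j = "\<lambda>\<phi>. (restrict \<phi> A, restrict \<phi> B)"])
  fix \<phi> assume \<phi>: "\<phi> \<in> A \<union> B \<rightarrow>\<^sub>E X"
  have *: "override_on (restrict \<phi> A) (restrict \<phi> B) B = \<phi>"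
  proof
    fix v show "override_on (restrict \<phi> A) (restrict \<phi> B) B v = \<phi> v"
      using PiE_arb[OF \<phi>] by (auto simp: override_on_def)
  qed
  then show "(case (restrict \<phi> A, restrict \<phi> B) of (y, x) \<Rightarrow> override_on y x B) = \<phi>"
    and "(case (restrict \<phi> A, restrict \<phi> B) of (y, x) \<Rightarrow> g (override_on y x B)) = g \<phi>"
    by simp_all
  show "(restrict \<phi> A, restrict \<phi> B) \<in> (A \<rightarrow>\<^sub>E X) \<times> (B \<rightarrow>\<^sub>E X)"
    using \<phi> by auto
next
  fix z assume "z \<in> (A \<rightarrow>\<^sub>E X) \<times> (B \<rightarrow>\<^sub>E X)"
  then obtain y x where z: "z = (y, x)" and y: "y \<in> A \<rightarrow>\<^sub>E X" and x: "x \<in> B \<rightarrow>\<^sub>E X"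
    by auto
  have "restrict (override_on y x B) A = y"
  proof
    fix v show "restrict (override_on y x B) A v = y v"
      using assms PiE_arb[OF y] by (auto simp: override_on_def)
  qed
  moreover have "restrict (override_on y x B) B = x"
  proof
    fix v show "restrict (override_on y x B) B v = x v"
      using PiE_arb[OF x] by (auto simp: override_on_def)
  qed
  ultimately show "(restrict (case z of (y, x) \<Rightarrow> override_on y x B) A,
      restrict (case z of (y, x) \<Rightarrow> override_on y x B) B) = z"
    by (simp add: z)
  have "override_on y x B v \<in> X" if "v \<in> A \<union> B" for v
    using x y that by (auto simp: override_on_def)
  moreover have "override_on y x B v = undefined" if "v \<notin> A \<union> B" for v
    using PiE_arb[OF y] that by (auto simp: override_on_def)
  ultimately show "(case z of (y, x) \<Rightarrow> override_on y x B) \<in> A \<union> B \<rightarrow>\<^sub>E X"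
    unfolding z by (simp only: prod.case) (rule PiE_I)
qed

lemma sum_PiE_bij:
  assumes "bij_betw h I A"
  shows "(\<Sum>i\<in>I \<rightarrow>\<^sub>E X. g i) = (\<Sum>x\<in>A \<rightarrow>\<^sub>E X. g (\<lambda>k\<in>I. x (h k)))"
proof -
  have inj: "inv_into I h (h k) = k" "h k \<in> A" if "k \<in> I" for k
    using assms that by (auto simp: bij_betw_def inv_into_f_f)
  have surj: "h (inv_into I h v) = v" "inv_into I h v \<in> I" if "v \<in> A" for v
    using assms that by (auto simp: bij_betw_def f_inv_into_f inv_into_into)
  have left: "(\<lambda>k\<in>I. (\<lambda>v\<in>A. i (inv_into I h v)) (h k)) = i" if "i \<in> I \<rightarrow>\<^sub>E X" for i
    using that by (auto simp: fun_eq_iff inj PiE_iff extensional_def)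
  have right: "(\<lambda>v\<in>A. (\<lambda>k\<in>I. x (h k)) (inv_into I h v)) = x" if "x \<in> A \<rightarrow>\<^sub>E X" for x
    using that by (auto simp: fun_eq_iff surj PiE_iff extensional_def)
  show ?thesis
    by (rule sum.reindex_bij_witness[where i = "\<lambda>x. \<lambda>k\<in>I. x (h k)"
          and j = "\<lambda>i. \<lambda>v\<in>A. i (inv_into I h v)"])
       (simp_all only: left right, auto simp: inj surj)
qed

text \<open>The coordinates in \<open>D\<close> are free, so each contributes a factor
  \<open>card X\<close>. With \<open>D = e - f\<close> this accounts for the weight
  \<open>n ^ (r - card f)\<close> in the norm of a face.\<close>

lemma sum_PiE_ignore:
  fixes g :: "('v \<Rightarrow> 'a) \<Rightarrow> real"
  assumes "finite V" and "D \<subseteq> V" and "\<And>w z. g (override_on w z D) = g w"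
  shows "(\<Sum>\<phi>\<in>V \<rightarrow>\<^sub>E X. g \<phi>) = real (card X) ^ card D * (\<Sum>w\<in>V - D \<rightarrow>\<^sub>E X. g w)"
proof -
  have V: "V = (V - D) \<union> D" using assms(2) by blast
  have "finite D" using assms finite_subset by blast
  then have "card (D \<rightarrow>\<^sub>E X) = card X ^ card D"
    by (simp add: card_PiE)
  then show ?thesis
    by (subst V, subst sum_PiE_Un) (auto simp: assms(3) sum_distrib_left)
qed

lemma prod_zero_one:
  fixes a :: "'a \<Rightarrow> 'b::comm_semiring_1"
  assumes "finite D" and "\<And>d. d \<in> D \<Longrightarrow> a d \<in> {0, 1}"
  shows "(\<Prod>d\<in>D. a d) = of_bool (\<forall>d\<in>D. a d = 1)"
  using assms by (induction D rule: finite_induct) auto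

text \<open>The sets \<open>D f\<close> may overlap. Both sides are the indicator that every
  \<open>a d\<close> equals 1, so multiplicities are invisible.\<close>

lemma prod_UNION_zero_one:
  fixes a :: "'a \<Rightarrow> real"
  assumes "finite F" and "\<And>f. f \<in> F \<Longrightarrow> finite (D f)"
    and "\<And>f d. f \<in> F \<Longrightarrow> d \<in> D f \<Longrightarrow> a d \<in> {0, 1}"
  shows "(\<Prod>f\<in>F. \<Prod>d\<in>D f. a d) = (\<Prod>d\<in>(\<Union>f\<in>F. D f). a d)"
proof -
  have "(\<Prod>f\<in>F. \<Prod>d\<in>D f. a d) = (\<Prod>f\<in>F. of_bool (\<forall>d\<in>D f. a d = 1))"
    by (rule prod.cong[OF refl], rule prod_zero_one) (use assms in auto)
  also have "\<dots> = of_bool (\<forall>d\<in>(\<Union>f\<in>F. D f). a d = 1)"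
    by (subst prod_zero_one) (use assms in auto)
  also have "\<dots> = (\<Prod>d\<in>(\<Union>f\<in>F. D f). a d)"
    by (rule prod_zero_one[symmetric]) (use assms in auto)
  finally show ?thesis .
qed

section \<open>Multiaffine functionals on convex hulls, and telescoping\<close>

text \<open>Coordinates pass from \<open>\<C>\<close> to its hull one at a time: with the others
  frozen, the values obeying the bound form a convex set, the preimage of an interval under an
  affine map, and this set contains \<open>\<C>\<close>. The centre \<open>c\<close> is arbitrary so
  that each argument of a difference can be treated in turn.\<close>

lemma multiaffine_convex_hull_bound:
  fixes G :: "('e \<Rightarrow> 'a::real_vector) \<Rightarrow> real"
  assumes D: "finite D"
    and affine: "\<And>S e u v X Y. e \<in> D \<Longrightarrow> u \<ge> 0 \<Longrightarrow> v \<ge> 0 \<Longrightarrow> u + v = 1 \<Longrightarrow>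
      G (S(e := u *\<^sub>R X + v *\<^sub>R Y)) = u * G (S(e := X)) + v * G (S(e := Y))"
    and bound: "\<And>S. \<forall>e\<in>D. S e \<in> \<C> \<Longrightarrow> \<bar>G S - c\<bar> \<le> b"
    and S: "\<forall>e\<in>D. S e \<in> convex hull \<C>"
  shows "\<bar>G S - c\<bar> \<le> b"
proof -
  have "\<bar>G S - c\<bar> \<le> b"
    if "finite D'" "D' \<subseteq> D" "\<forall>e\<in>D'. S e \<in> convex hull \<C>" "\<forall>e\<in>D - D'. S e \<in> \<C>" for D' S
    using that
  proof (induction D' arbitrary: S rule: finite_induct)
    case empty
    then show ?case using bound by auto
  next
    case (insert e D')
    let ?K = "{X. \<bar>G (S(e := X)) - c\<bar> \<le> b}"
    have "\<C> \<subseteq> ?K"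
      using insert.prems insert.hyps by (auto intro!: insert.IH)
    moreover have "convex ?K"
    proof (rule convexI)
      fix X Y :: 'a and u v :: real
      assume uv: "0 \<le> u" "0 \<le> v" "u + v = 1"
        and X: "X \<in> ?K" and Y: "Y \<in> ?K"
      have *: "u * G (S(e := X)) + v * G (S(e := Y)) - c
          = u * (G (S(e := X)) - c) + v * (G (S(e := Y)) - c)"
        using distrib_right[of u v c] uv by (simp add: right_diff_distrib)
      have "\<bar>u * G (S(e := X)) + v * G (S(e := Y)) - c\<bar> \<le> u * \<bar>G (S(e := X)) - c\<bar> + v * \<bar>G (S(e := Y)) - c\<bar>"
        using uv unfolding * by (intro order_trans[OF abs_triangle_ineq]) (simp add: abs_mult)
      also have "\<dots> \<le> b"
        using X Y uv by (intro convex_bound_le) auto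
      finally show "u *\<^sub>R X + v *\<^sub>R Y \<in> ?K"
        using affine[of e u v S X Y] uv insert.prems by simp
    qed
    ultimately have "convex hull \<C> \<subseteq> ?K"
      by (rule hull_minimal)
    with insert.prems have "S e \<in> ?K" by auto
    then show ?case by simp
  qed
  from this[of D S] D S show ?thesis by simp
qed

text \<open>The coordinates of \<open>P\<close> are exchanged for those of \<open>Q\<close> one at a
  time, at cost \<open>b\<close> each, and all intermediate families stay in \<open>\<C>\<close>. At
  the end the two families agree only on \<open>D\<close>, whence \<open>cong\<close>.\<close>

lemma telescoping_bound:
  fixes G :: "('e \<Rightarrow> 'a) \<Rightarrow> real"
  assumes D: "finite D"
    and cong: "\<And>S S'. (\<forall>e\<in>D. S e = S' e) \<Longrightarrow> G S = G S'"
    and step: "\<And>S e X Y. e \<in> D \<Longrightarrow> \<forall>e\<in>D. S e \<in> \<C> \<Longrightarrow> X \<in> \<C> \<Longrightarrow> Y \<in> \<C> \<Longrightarrow>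
      \<bar>G (S(e := X)) - G (S(e := Y))\<bar> \<le> b"
    and P: "\<forall>e\<in>D. P e \<in> \<C>" and Q: "\<forall>e\<in>D. Q e \<in> \<C>"
  shows "\<bar>G P - G Q\<bar> \<le> real (card D) * b"
proof -
  have "\<bar>G P - G Q\<bar> \<le> real (card D') * b"
    if "finite D'" "D' \<subseteq> D" "\<forall>e\<in>D. P e \<in> \<C>" "\<forall>e\<in>D - D'. P e = Q e" for D' P
    using that
  proof (induction D' arbitrary: P rule: finite_induct)
    case empty
    then show ?case using cong[of P Q] by auto
  next
    case (insert e D')
    have e: "e \<in> D" using insert.prems by auto
    have "\<bar>G (P(e := Q e)) - G Q\<bar> \<le> real (card D') * b"
      using insert.prems insert.hyps Q by (intro insert.IH) auto
    moreover have "\<bar>G (P(e := P e)) - G (P(e := Q e))\<bar> \<le> b"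
      using insert.prems e Q by (intro step) auto
    ultimately show ?case
      using insert.hyps by (simp add: algebra_simps)
  qed
  from this[of D P] D P show ?thesis by simp
qed

section \<open>Edge tuples and elementary properties of densities\<close>

text \<open>The enumeration chosen in \<open>edge_tuple\<close> depends on \<open>e\<close> alone
  and takes values in \<open>e\<close>, so the map is never read elsewhere.\<close>

lemma edge_tuple_cong:
  assumes "finite e" and "card e = r" and "\<And>v. v \<in> e \<Longrightarrow> \<phi> v = \<psi> v"
  shows "edge_tuple r \<phi> e = edge_tuple r \<psi> e"
proof -
  obtain h where "bij_betw h {1..r} e"
    using ex_bij_betw_nat_finite_1[OF assms(1)] assms(2) by auto
  then have "bij_betw (SOME \<nu>. bij_betw \<nu> {1..r} e) {1..r} e"
    by (rule someI[of "\<lambda>\<nu>. bij_betw \<nu> {1..r} e"])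
  then have "(SOME \<nu>. bij_betw \<nu> {1..r} e) k \<in> e" if "k \<in> {1..r}" for k
    using that by (rule bij_betwE[THEN bspec])
  then show ?thesis
    unfolding edge_tuple_def using assms(3) by (intro restrict_ext) metis
qed

text \<open>Two enumerations of \<open>e\<close> differ by a permutation of positions, which a
  symmetric tensor does not see. This replaces the arbitrary choice in \<open>edge_tuple\<close> by
  the labelling of a weighted base.\<close>

lemma symmetric_tensor_edge_tuple:
  assumes Z: "Z \<in> symmetric_tensors n r"
    and lab: "bij_betw h {1..r} e"
    and \<phi>: "\<And>v. v \<in> e \<Longrightarrow> \<phi> v \<in> {1..n}"
  shows "Z (edge_tuple r \<phi> e) = Z (\<lambda>k\<in>{1..r}. \<phi> (h k))"
proof -
  define \<nu> where "\<nu> = (SOME \<nu>. bij_betw \<nu> {1..r} e)"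
  have \<nu>: "bij_betw \<nu> {1..r} e"
    unfolding \<nu>_def using lab by (rule someI[of "\<lambda>\<nu>. bij_betw \<nu> {1..r} e"])
  define i where "i = (\<lambda>k\<in>{1..r}. \<phi> (h k))"
  \<comment> \<open>The permutation that carries one enumeration to the other, extended by the
    identity as \<open>permutes\<close> demands.\<close>
  define \<sigma> where "\<sigma> k = (if k \<in> {1..r} then inv_into {1..r} h (\<nu> k) else k)" for k
  have "bij_betw (inv_into {1..r} h \<circ> \<nu>) {1..r} {1..r}"
    using \<nu> bij_betw_inv_into[OF lab] by (rule bij_betw_trans)
  then have "bij_betw \<sigma> {1..r} {1..r}"
    by (subst bij_betw_cong[of _ _ "inv_into {1..r} h \<circ> \<nu>"]) (auto simp: \<sigma>_def)
  then have "\<sigma> permutes {1..r}"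
    by (rule bij_imp_permutes) (auto simp: \<sigma>_def)
  moreover have "i \<in> index_tuples n r"
    using lab \<phi> by (auto simp: i_def bij_betw_def)
  ultimately have "Z (i \<circ> \<sigma>) = Z i"
    using Z by (auto simp: symmetric_tensors_def)
  moreover have "i \<circ> \<sigma> = edge_tuple r \<phi> e"
  proof
    fix k
    show "(i \<circ> \<sigma>) k = edge_tuple r \<phi> e k"
    proof (cases "k \<in> {1..r}")
      case True
      then have "\<nu> k \<in> h ` {1..r}"
        using lab \<nu> by (auto simp: bij_betw_def)
      then have "h (inv_into {1..r} h (\<nu> k)) = \<nu> k" "inv_into {1..r} h (\<nu> k) \<in> {1..r}"
        by (rule f_inv_into_f, rule inv_into_into)
      then show ?thesis
        using True unfolding edge_tuple_def \<nu>_def[symmetric] by (simp add: i_def \<sigma>_def)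
    next
      case False
      then show ?thesis
        by (auto simp: i_def \<sigma>_def edge_tuple_def)
    qed
  qed
  ultimately show ?thesis by (simp add: i_def)
qed

lemma adjacency_tensor_zero_one: "S \<in> adjacency_tensors n r \<Longrightarrow> S i \<in> {0, 1}"
  by (cases "i \<in> index_tuples n r") (auto simp: adjacency_tensors_def symmetric_tensors_def)

lemma hom_density_cong:
  "(\<forall>e\<in>E. S e = S' e) \<Longrightarrow> hom_density r n p V E S = hom_density r n p V E S'"
  unfolding hom_density_def
  by (intro arg_cong2[where f = "(*)"] sum.cong prod.cong refl) simp

lemma hom_density_update:
  assumes "finite E" and "e \<in> E"
  shows "hom_density r n p V E (S(e := X)) = 1 / (real n ^ card V * p ^ card E) *
     (\<Sum>\<phi> \<in> V \<rightarrow>\<^sub>E {1..n}. X (edge_tuple r \<phi> e) * (\<Prod>e'\<in>E - {e}. S e' (edge_tuple r \<phi> e')))"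
  unfolding hom_density_def
  by (intro arg_cong2[where f = "(*)"] sum.cong refl)
     (simp add: prod.remove[OF assms])

lemma hom_density_affine:
  assumes "finite E" and "e \<in> E"
  shows "hom_density r n p V E (S(e := u *\<^sub>R X + v *\<^sub>R Y))
    = u * hom_density r n p V E (S(e := X)) + v * hom_density r n p V E (S(e := Y))"
proof -
  have "(u *\<^sub>R X + v *\<^sub>R Y) i * a = u * (X i * a) + v * (Y i * a)" for i and a :: real
    by (simp add: scaleR_fun_def distrib_right)
  then show ?thesis
    unfolding hom_density_update[OF assms]
    by (simp only: sum.distrib flip: sum_distrib_left) (simp only: distrib_left mult.left_commute)
qed

section \<open>Dominating base systems and their test tensors\<close>

text \<open>Degrees and base system refer to the full edge set \<open>E\<close>. Subgraphs are
  treated in the same context as edge sets \<open>E' \<subseteq> E\<close> on the same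
  \<open>V\<close>, so the induction over subgraphs needs no new base systems.\<close>

locale dominated_tensors =
  fixes r :: nat and V :: "'v set" and E :: "'v set set"
    and p :: real and n :: nat and BB :: "'v set \<Rightarrow> 'v weighted_base"
    and \<C> :: "tensor set" and \<epsilon> :: real
  assumes r: "r \<ge> 1" and hypergraph: "uniform_hypergraph r V E"
    and p: "0 < p" "p \<le> 1" and n: "n \<ge> 1"
    and system: "is_base_system r E BB" and dominating: "dominating E BB"
    and topdeg: "\<And>e. e \<in> E \<Longrightarrow> topdeg (BB e) = edge_degree E e"
    and subdeg: "\<And>e f. e \<in> E \<Longrightarrow> f \<in> base (BB e) \<Longrightarrow> subdeg (BB e) f = edge_subdegree E e f"
    and adjacency: "\<C> \<subseteq> adjacency_tensors n r"
    and \<epsilon>: "0 \<le> \<epsilon>"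
    and diameter: "\<And>A B. A \<in> \<C> \<Longrightarrow> B \<in> \<C> \<Longrightarrow> system_norm n p E BB (A - B) \<le> \<epsilon> * p"
begin

lemma finite_V: "finite V"
  and edge_subset: "e \<in> E \<Longrightarrow> e \<subseteq> V"
  and card_edge: "e \<in> E \<Longrightarrow> card e = r"
  using hypergraph by (auto simp: uniform_hypergraph_def)

lemma finite_E: "finite E"
  using finite_V edge_subset by (meson finite_Pow_iff finite_subset PowI subsetI)

lemma finite_edge: "e \<in> E \<Longrightarrow> finite e"
  using finite_V edge_subset finite_subset by blast

lemma edge_nonempty: "e \<in> E \<Longrightarrow> e \<noteq> {}"
  using card_edge r by fastforce

lemma
  assumes "e \<in> E"
  shows uniformity_BB: "uniformity (BB e) = r"
    and labelling_BB: "bij_betw (labelling (BB e)) {1..r} e"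
    and base_subset: "f \<in> base (BB e) \<Longrightarrow> f \<subset> e"
    and empty_base: "{} \<in> base (BB e)"
proof -
  have *: "is_weighted_base (BB e)" "uniformity (BB e) = r" "ground (BB e) = e"
    using system assms by (auto simp: is_base_system_def)
  show "uniformity (BB e) = r" by fact
  show "bij_betw (labelling (BB e)) {1..r} e" "{} \<in> base (BB e)"
    using * by (auto simp: is_weighted_base_def is_base_def)
  show "f \<subset> e" if "f \<in> base (BB e)"
    using * that unfolding is_weighted_base_def is_base_def by metis
qed

lemma finite_base: "e \<in> E \<Longrightarrow> finite (base (BB e))"
  by (rule finite_subset[of _ "Pow e"]) (use base_subset finite_edge in auto)

lemma card_base: "e \<in> E \<Longrightarrow> card (base (BB e)) \<le> 2 ^ r"
  using card_mono[of "Pow e" "base (BB e)"] base_subset finite_edge card_edge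
  by (auto simp: card_Pow)

lemma proj_in:
  assumes "e \<in> E" and "f \<in> base (BB e)" and "i \<in> index_tuples n r"
  shows "proj (BB e) f i \<in> f \<rightarrow>\<^sub>E {1..n}"
proof -
  have "inv_into {1..r} (labelling (BB e)) v \<in> {1..r}" if "v \<in> f" for v
    using labelling_BB[OF assms(1)] base_subset[OF assms(1,2)] that
    by (intro inv_into_into) (auto simp: bij_betw_def)
  with assms show ?thesis
    by (auto simp: proj_def uniformity_BB)
qed

text \<open>\<open>proj\<close> inverts the labelling through which the tuple was read, so in vertex
  coordinates the projection is plain restriction.\<close>

lemma proj_relabel:
  assumes "e \<in> E" and "f \<in> base (BB e)"
  shows "proj (BB e) f (\<lambda>k\<in>{1..r}. x (labelling (BB e) k)) = restrict x f"
proof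
  fix v
  show "proj (BB e) f (\<lambda>k\<in>{1..r}. x (labelling (BB e) k)) v = restrict x f v"
  proof (cases "v \<in> f")
    case True
    then have "v \<in> labelling (BB e) ` {1..r}"
      using labelling_BB[OF assms(1)] base_subset[OF assms] by (auto simp: bij_betw_def)
    then have "inv_into {1..r} (labelling (BB e)) v \<in> {1..r}"
      "labelling (BB e) (inv_into {1..r} (labelling (BB e)) v) = v"
      by (rule inv_into_into, rule f_inv_into_f)
    with True show ?thesis
      by (simp add: proj_def uniformity_BB[OF assms(1)])
  qed (simp add: proj_def)
qed

lemma inner_le_norms:
  assumes A: "A \<in> \<C>" and B: "B \<in> \<C>" and e: "e \<in> E"
    and \<tau>: "\<tau> \<in> (\<Pi>\<^sub>E f\<in>base (BB e). (f \<rightarrow>\<^sub>E {1..n}) \<rightarrow>\<^sub>E {0, 1})"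
    and \<tau>0: "\<And>x. x \<in> {} \<rightarrow>\<^sub>E {1..n} \<Longrightarrow> \<tau> {} x = 1"
  shows "\<bar>tensor_inner n r (A - B) (factor_tensor (BB e) \<tau>)\<bar>
    \<le> \<epsilon> * p * (norm1 n (BB e) \<tau> + (\<Sum>f\<in>base (BB e). face_norm n p (BB e) \<tau> f))"
proof -
  note [simp] = uniformity_BB[OF e]
  have \<tau>01: "\<tau> f x \<in> {0, 1}" if "f \<in> base (BB e)" "x \<in> f \<rightarrow>\<^sub>E {1..n}" for f x
  proof -
    have "\<tau> f \<in> (f \<rightarrow>\<^sub>E {1..n}) \<rightarrow>\<^sub>E {0, 1}"
      using \<tau> that(1) by (rule PiE_mem)
    then show ?thesis
      using that(2) by (rule PiE_mem)
  qed
  have \<tau>_nonneg: "\<tau> f x \<ge> 0" if "f \<in> base (BB e)" "x \<in> f \<rightarrow>\<^sub>E {1..n}" for f x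
    using \<tau>01[OF that] by auto
  have face0: "face_norm n p (BB e) \<tau> f \<ge> 0" if "f \<in> base (BB e)" for f
    unfolding face_norm_def using p
    by (intro mult_nonneg_nonneg sum_nonneg \<tau>_nonneg[OF that]) auto
  have "factor_tensor (BB e) \<tau> i \<ge> 0" if "i \<in> index_tuples n r" for i
    unfolding factor_tensor_def
    by (intro prod_nonneg \<tau>_nonneg proj_in[OF e _ that]) auto
  then have norm0: "norm1 n (BB e) \<tau> \<ge> 0"
    unfolding norm1_def by (intro sum_nonneg) auto
  show ?thesis
  proof (cases "\<tau> \<in> test_factors n (BB e)")
    case False
    then have "factor_tensor (BB e) \<tau> i = 0" if "i \<in> index_tuples n r" for i
      using \<tau> \<tau>0 that by (auto simp: test_factors_def)
    then have "tensor_inner n r (A - B) (factor_tensor (BB e) \<tau>) = 0"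
      unfolding tensor_inner_def by simp
    then show ?thesis
      using norm0 face0 \<epsilon> p by (simp add: sum_nonneg)
  next
    case True
    have fin: "finite (test_factors n (BB e))"
    proof (rule finite_subset)
      show "test_factors n (BB e) \<subseteq> (\<Pi>\<^sub>E f\<in>base (BB e). (f \<rightarrow>\<^sub>E {1..n}) \<rightarrow>\<^sub>E {0, 1})"
        by (auto simp: test_factors_def)
      have "finite f" if "f \<in> base (BB e)" for f
        using base_subset[OF e that] finite_edge[OF e] finite_subset by blast
      then show "finite (\<Pi>\<^sub>E f\<in>base (BB e). (f \<rightarrow>\<^sub>E {1..n}) \<rightarrow>\<^sub>E {0, 1::real})"
        using finite_base[OF e] by (intro finite_PiE) auto
    qed
    have "\<bar>tensor_inner n r (A - B) (factor_tensor (BB e) \<tau>)\<bar> / test_norm n p (BB e) \<tau>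
        \<le> base_norm n p (BB e) (A - B)"
      unfolding base_norm_def using True fin by (intro Max_ge) auto
    also have "\<dots> \<le> system_norm n p E BB (A - B)"
      unfolding system_norm_def using e finite_E by (intro Max_ge) auto
    also have "\<dots> \<le> \<epsilon> * p"
      using A B by (rule diameter)
    finally have quot: "\<bar>tensor_inner n r (A - B) (factor_tensor (BB e) \<tau>)\<bar> /
      test_norm n p (BB e) \<tau> \<le> \<epsilon> * p" .
    \<comment> \<open>The empty face contributes \<open>n ^ r\<close> times a power of
      \<open>p\<close>, so the test norm is positive and the quotient can be cleared.\<close>
    have "0 < face_norm n p (BB e) \<tau> {}"
      using \<tau>0 n p by (simp add: face_norm_def)
    also have "\<dots> \<le> (MAX f\<in>base (BB e). face_norm n p (BB e) \<tau> f)"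
      using empty_base[OF e] finite_base[OF e] by (intro Max_ge) auto
    also have "\<dots> \<le> test_norm n p (BB e) \<tau>"
      by (simp add: test_norm_def)
    finally have pos: "test_norm n p (BB e) \<tau> > 0" .
    have "face_norm n p (BB e) \<tau> f \<le> (\<Sum>f\<in>base (BB e). face_norm n p (BB e) \<tau> f)"
      if "f \<in> base (BB e)" for f
      using finite_base[OF e] face0 that by (intro member_le_sum) auto
    then have "(MAX f\<in>base (BB e). face_norm n p (BB e) \<tau> f)
        \<le> (\<Sum>f\<in>base (BB e). face_norm n p (BB e) \<tau> f)"
      using empty_base[OF e] finite_base[OF e] by (intro Max.boundedI) auto
    then have "test_norm n p (BB e) \<tau>
        \<le> norm1 n (BB e) \<tau> + (\<Sum>f\<in>base (BB e). face_norm n p (BB e) \<tau> f)"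
      using norm0 sum_nonneg[of "base (BB e)" "face_norm n p (BB e) \<tau>"] face0
      by (auto simp: test_norm_def)
    then have "\<epsilon> * p * test_norm n p (BB e) \<tau>
        \<le> \<epsilon> * p * (norm1 n (BB e) \<tau> + (\<Sum>f\<in>base (BB e). face_norm n p (BB e) \<tau> f))"
      using \<epsilon> p by (intro mult_left_mono) auto
    moreover have "\<bar>tensor_inner n r (A - B) (factor_tensor (BB e) \<tau>)\<bar>
        \<le> \<epsilon> * p * test_norm n p (BB e) \<tau>"
      using quot pos by (simp add: divide_le_eq)
    ultimately show ?thesis by linarith
  qed
qed

section \<open>Changing the tensor on a single edge\<close>

text \<open>Every subgraph keeps the full vertex set, so that all these sums share the normalisation
  \<open>n ^ card V\<close>.\<close>

definition hom_sum :: "'v set set \<Rightarrow> ('v set \<Rightarrow> tensor) \<Rightarrow> real" where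
  "hom_sum E' S = (\<Sum>\<phi> \<in> V \<rightarrow>\<^sub>E {1..n}. \<Prod>e'\<in>E'. S e' (edge_tuple r \<phi> e'))"

text \<open>After the coordinates in \<open>e - f\<close> are summed freely, these are the edges
  retained by the face norm at \<open>f\<close>. Edges disjoint from \<open>e\<close> belong here
  but not to \<open>shared_edges\<close>, whose product is the factor of the test tensor at
  \<open>f\<close>.\<close>

definition face_edges :: "'v set set \<Rightarrow> 'v set \<Rightarrow> 'v set \<Rightarrow> 'v set set" where
  "face_edges E' e f = {e' \<in> E' - {e}. e' \<inter> e \<subseteq> f}"

definition shared_edges :: "'v set set \<Rightarrow> 'v set \<Rightarrow> 'v set \<Rightarrow> 'v set set" where
  "shared_edges E' e f = {e' \<in> E'. e' \<inter> e \<noteq> {} \<and> e' \<inter> e \<subseteq> f}"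

lemma edge_tuple_cong_E:
  "e \<in> E \<Longrightarrow> (\<And>v. v \<in> e \<Longrightarrow> \<phi> v = \<psi> v) \<Longrightarrow> edge_tuple r \<phi> e = edge_tuple r \<psi> e"
  by (rule edge_tuple_cong) (use finite_edge card_edge in auto)

text \<open>Domination places each other edge meeting \<open>e\<close> in some face. The edge
  \<open>e\<close> itself is excluded because faces are proper subsets of \<open>e\<close>.\<close>

lemma UN_shared_edges:
  assumes "e \<in> E" and "E' \<subseteq> E"
  shows "(\<Union>f\<in>base (BB e). shared_edges E' e f) = {e' \<in> E' - {e}. e' \<inter> e \<noteq> {}}"
proof (intro equalityI subsetI)
  fix e' assume "e' \<in> (\<Union>f\<in>base (BB e). shared_edges E' e f)"
  then obtain f where "f \<in> base (BB e)" "e' \<in> E'" "e' \<inter> e \<noteq> {}" "e' \<inter> e \<subseteq> f"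
    by (auto simp: shared_edges_def)
  then show "e' \<in> {e' \<in> E' - {e}. e' \<inter> e \<noteq> {}}"
    using base_subset[OF assms(1)] by blast
next
  fix e' assume e': "e' \<in> {e' \<in> E' - {e}. e' \<inter> e \<noteq> {}}"
  then obtain f where "f \<in> base (BB e)" "e \<inter> e' \<subseteq> f"
    using dominating assms unfolding dominating_def by blast
  then show "e' \<in> (\<Union>f\<in>base (BB e). shared_edges E' e f)"
    using e' by (auto simp: shared_edges_def)
qed

text \<open>Edges disjoint from \<open>e\<close> give a constant \<open>c\<close> on the fibre over
  \<open>y\<close>, the remaining ones a test tensor. The claim is \<open>inner_le_norms\<close>
  multiplied by \<open>c\<close>: this turns the 1-norm into a sum of products over all edges other
  than \<open>e\<close>, and the norm at \<open>f\<close> into one over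
  \<open>face_edges\<close>.\<close>

lemma fiber_bound:
  assumes E': "E' \<subseteq> E" and e: "e \<in> E'" and S: "\<forall>e'\<in>E'. S e' \<in> \<C>"
    and A: "A \<in> \<C>" and B: "B \<in> \<C>" and y: "y \<in> V - e \<rightarrow>\<^sub>E {1..n}"
  shows "\<bar>\<Sum>x\<in>e \<rightarrow>\<^sub>E {1..n}. (A - B) (edge_tuple r (override_on y x e) e) *
      (\<Prod>e'\<in>E' - {e}. S e' (edge_tuple r (override_on y x e) e'))\<bar>
    \<le> \<epsilon> * p * ((\<Sum>x\<in>e \<rightarrow>\<^sub>E {1..n}. \<Prod>e'\<in>E' - {e}. S e' (edge_tuple r (override_on y x e) e')) +
      (\<Sum>f\<in>base (BB e). real n ^ (r - card f) * p ^ (edge_degree E e - edge_subdegree E e f) *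
        (\<Sum>x\<in>f \<rightarrow>\<^sub>E {1..n}. \<Prod>e'\<in>face_edges E' e f. S e' (edge_tuple r (override_on y x f) e'))))"
    (is "_ \<le> \<epsilon> * p * (?N + ?F)")
proof -
  have eE: "e \<in> E" and finE': "finite E'"
    using E' e finite_E finite_subset by auto
  define w where "w \<phi> e' = S e' (edge_tuple r \<phi> e')" for \<phi> e'
  have w01: "w \<phi> e' \<in> {0, 1}" if "e' \<in> E'" for \<phi> e'
    unfolding w_def using S that adjacency adjacency_tensor_zero_one[of "S e'" n r] by auto
  have w_cong: "w \<phi> e' = w \<psi> e'" if "e' \<in> E'" "\<And>v. v \<in> e' \<Longrightarrow> \<phi> v = \<psi> v" for \<phi> \<psi> e'
    unfolding w_def using edge_tuple_cong_E[of e' \<phi> \<psi>] that E' by auto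
  define c where "c = (\<Prod>e'\<in>{e' \<in> E'. e' \<inter> e = {}}. w y e')"
  have c0: "c \<ge> 0"
    unfolding c_def by (subst prod_zero_one) (use finE' w01 in auto)
  \<comment> \<open>On \<open>e - f\<close> the glued map takes the value of \<open>y\<close>, which
    is \<open>undefined\<close> there. An edge in \<open>shared_edges E' e f\<close> meets
    \<open>e\<close> only inside \<open>f\<close>, so this default is never read.\<close>
  define \<tau> where "\<tau> = (\<lambda>f\<in>base (BB e). \<lambda>x\<in>f \<rightarrow>\<^sub>E {1..n}.
    \<Prod>e'\<in>shared_edges E' e f. w (override_on y x f) e')"
  define tup where "tup x = (\<lambda>k\<in>{1..r}. x (labelling (BB e) k))" for x :: "'v \<Rightarrow> nat"
  have fin_shared: "finite (shared_edges E' e f)" for f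
    using finE' by (simp add: shared_edges_def)

  have factor: "factor_tensor (BB e) \<tau> (tup x)
      = (\<Prod>e'\<in>{e' \<in> E' - {e}. e' \<inter> e \<noteq> {}}. w (override_on y x e) e')"
    if x: "x \<in> e \<rightarrow>\<^sub>E {1..n}" for x
  proof -
    have "\<tau> f (proj (BB e) f (tup x)) = (\<Prod>e'\<in>shared_edges E' e f. w (override_on y x e) e')"
      if f: "f \<in> base (BB e)" for f
    proof -
      have fe: "f \<subset> e" using base_subset[OF eE f] .
      then have "restrict x f \<in> f \<rightarrow>\<^sub>E {1..n}"
        using x by auto
      then have "\<tau> f (proj (BB e) f (tup x))
          = (\<Prod>e'\<in>shared_edges E' e f. w (override_on y (restrict x f) f) e')"
        unfolding tup_def proj_relabel[OF eE f] using f by (simp add: \<tau>_def)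
      also have "\<dots> = (\<Prod>e'\<in>shared_edges E' e f. w (override_on y x e) e')"
        by (intro prod.cong refl w_cong)
           (use fe in \<open>auto simp: shared_edges_def override_on_def\<close>)
      finally show ?thesis .
    qed
    then have "factor_tensor (BB e) \<tau> (tup x)
        = (\<Prod>f\<in>base (BB e). \<Prod>e'\<in>shared_edges E' e f. w (override_on y x e) e')"
      unfolding factor_tensor_def by (intro prod.cong) auto
    also have "\<dots> = (\<Prod>e'\<in>(\<Union>f\<in>base (BB e). shared_edges E' e f). w (override_on y x e) e')"
      by (rule prod_UNION_zero_one[OF finite_base[OF eE] fin_shared w01])
         (simp add: shared_edges_def)
    finally show ?thesis
      by (simp only: UN_shared_edges[OF eE E'])
  qed

  have split_c: "(\<Prod>e'\<in>E' - {e}. w (override_on y x e) e') = c * factor_tensor (BB e) \<tau> (tup x)"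
    if x: "x \<in> e \<rightarrow>\<^sub>E {1..n}" for x
  proof -
    \<comment> \<open>The edge \<open>e\<close> meets itself because it is nonempty, so the class of
      edges disjoint from \<open>e\<close> does not contain it.\<close>
    have E'_split: "E' - {e} = {e' \<in> E'. e' \<inter> e = {}} \<union> {e' \<in> E' - {e}. e' \<inter> e \<noteq> {}}"
      using edge_nonempty[OF eE] by auto
    have "(\<Prod>e'\<in>E' - {e}. w (override_on y x e) e')
        = (\<Prod>e'\<in>{e' \<in> E'. e' \<inter> e = {}}. w (override_on y x e) e') *
          (\<Prod>e'\<in>{e' \<in> E' - {e}. e' \<inter> e \<noteq> {}}. w (override_on y x e) e')"
      by (subst E'_split, rule prod.union_disjoint) (use finE' in auto)
    moreover have "(\<Prod>e'\<in>{e' \<in> E'. e' \<inter> e = {}}. w (override_on y x e) e') = c"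
      unfolding c_def by (intro prod.cong refl w_cong) (auto simp: override_on_def)
    ultimately show ?thesis
      by (simp only: factor[OF x])
  qed

  \<comment> \<open>The same \<open>c\<close> occurs at every face, because edges disjoint from
    \<open>e\<close> see only \<open>y\<close>.\<close>
  have face: "(\<Prod>e'\<in>face_edges E' e f. w (override_on y x f) e') = c * \<tau> f x"
    if f: "f \<in> base (BB e)" and x: "x \<in> f \<rightarrow>\<^sub>E {1..n}" for f x
  proof -
    have fe: "f \<subset> e" using base_subset[OF eE f] .
    then have face_split: "face_edges E' e f = {e' \<in> E'. e' \<inter> e = {}} \<union> shared_edges E' e f"
      using edge_nonempty[OF eE] by (auto simp: face_edges_def shared_edges_def)
    have "(\<Prod>e'\<in>face_edges E' e f. w (override_on y x f) e')
        = (\<Prod>e'\<in>{e' \<in> E'. e' \<inter> e = {}}. w (override_on y x f) e') *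
          (\<Prod>e'\<in>shared_edges E' e f. w (override_on y x f) e')"
      by (subst face_split, rule prod.union_disjoint)
         (use finE' fin_shared in \<open>auto simp: shared_edges_def\<close>)
    moreover have "(\<Prod>e'\<in>{e' \<in> E'. e' \<inter> e = {}}. w (override_on y x f) e') = c"
      unfolding c_def by (intro prod.cong refl w_cong) (use fe in \<open>auto simp: override_on_def\<close>)
    ultimately show ?thesis
      using f x by (simp add: \<tau>_def)
  qed

  have tup: "Z (edge_tuple r (override_on y x e) e) = Z (tup x)"
    if x: "x \<in> e \<rightarrow>\<^sub>E {1..n}" and Z: "Z \<in> \<C>" for x and Z :: tensor
  proof -
    have "Z \<in> symmetric_tensors n r"
      using Z adjacency by (auto simp: adjacency_tensors_def)
    then have "Z (edge_tuple r (override_on y x e) e)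
        = Z (\<lambda>k\<in>{1..r}. override_on y x e (labelling (BB e) k))"
      by (rule symmetric_tensor_edge_tuple[OF _ labelling_BB[OF eE]])
         (use PiE_mem[OF x] in \<open>auto simp: override_on_def\<close>)
    also have "(\<lambda>k\<in>{1..r}. override_on y x e (labelling (BB e) k)) = tup x"
      unfolding tup_def using bij_betwE[OF labelling_BB[OF eE]]
      by (intro restrict_ext) (auto simp: override_on_def)
    finally show ?thesis .
  qed

  have sum_tup: "(\<Sum>i\<in>index_tuples n r. h i) = (\<Sum>x\<in>e \<rightarrow>\<^sub>E {1..n}. h (tup x))" for h :: tensor
    unfolding tup_def by (rule sum_PiE_bij[OF labelling_BB[OF eE]])
  have inner: "(\<Sum>x\<in>e \<rightarrow>\<^sub>E {1..n}. (A - B) (edge_tuple r (override_on y x e) e) *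
      (\<Prod>e'\<in>E' - {e}. w (override_on y x e) e'))
      = c * tensor_inner n r (A - B) (factor_tensor (BB e) \<tau>)"
    unfolding tensor_inner_def sum_tup sum_distrib_left
    by (intro sum.cong refl) (simp add: split_c tup A B)
  have "\<bar>tensor_inner n r (A - B) (factor_tensor (BB e) \<tau>)\<bar>
    \<le> \<epsilon> * p * (norm1 n (BB e) \<tau> + (\<Sum>f\<in>base (BB e). face_norm n p (BB e) \<tau> f))"
  proof (rule inner_le_norms[OF A B eE])
    have "(\<Prod>e'\<in>shared_edges E' e f. w (override_on y x f) e') \<in> {0, 1}" for f x
      by (subst prod_zero_one[OF fin_shared w01]) (auto simp: shared_edges_def)
    then show "\<tau> \<in> (\<Pi>\<^sub>E f\<in>base (BB e). (f \<rightarrow>\<^sub>E {1..n}) \<rightarrow>\<^sub>E {0, 1})"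
      unfolding \<tau>_def by (intro restrict_PiE_iff[THEN iffD2] ballI)
    show "\<tau> {} x = 1" if "x \<in> {} \<rightarrow>\<^sub>E {1..n}" for x
    proof -
      \<comment> \<open>No edge can meet \<open>e\<close> inside the empty face, so the factor there
        is an empty product, as required of a test tensor.\<close>
      have "shared_edges E' e {} = {}"
        by (auto simp: shared_edges_def)
      then show ?thesis
        using that empty_base[OF eE] by (simp add: \<tau>_def)
    qed
  qed
  then have bound: "c * \<bar>tensor_inner n r (A - B) (factor_tensor (BB e) \<tau>)\<bar>
    \<le> c * (\<epsilon> * p * (norm1 n (BB e) \<tau> + (\<Sum>f\<in>base (BB e). face_norm n p (BB e) \<tau> f)))"
    using c0 by (rule mult_left_mono)
  have norm1: "c * norm1 n (BB e) \<tau> = ?N"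
    unfolding norm1_def uniformity_BB[OF eE] sum_tup sum_distrib_left w_def[symmetric]
    by (intro sum.cong refl) (simp add: split_c)
  have faces: "c * (\<Sum>f\<in>base (BB e). face_norm n p (BB e) \<tau> f) = ?F"
    unfolding sum_distrib_left w_def[symmetric] face_norm_def uniformity_BB[OF eE] topdeg[OF eE]
    by (intro sum.cong refl) (simp add: face subdeg[OF eE] mult_ac flip: sum_distrib_left)
  have "\<bar>\<Sum>x\<in>e \<rightarrow>\<^sub>E {1..n}. (A - B) (edge_tuple r (override_on y x e) e) *
      (\<Prod>e'\<in>E' - {e}. S e' (edge_tuple r (override_on y x e) e'))\<bar>
      = c * \<bar>tensor_inner n r (A - B) (factor_tensor (BB e) \<tau>)\<bar>"
    using c0 unfolding inner[unfolded w_def] by (simp only: abs_mult abs_of_nonneg)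
  also have "\<dots> \<le> \<epsilon> * p * (c * norm1 n (BB e) \<tau> +
      c * (\<Sum>f\<in>base (BB e). face_norm n p (BB e) \<tau> f))"
    using bound by (simp only: distrib_left mult.left_commute)
  finally show ?thesis
    by (simp only: norm1 faces)
qed

text \<open>\<open>fiber_bound\<close> is summed over all \<open>y\<close>. A face sum then runs
  over maps on \<open>(V - e) \<union> f\<close> only; the weight \<open>n ^ (r - card f)\<close>
  counts their free extensions to \<open>e - f\<close> and restores a sum over maps on
  \<open>V\<close>.\<close>

lemma edge_change_sum:
  assumes E': "E' \<subseteq> E" and e: "e \<in> E'" and S: "\<forall>e'\<in>E'. S e' \<in> \<C>"
    and A: "A \<in> \<C>" and B: "B \<in> \<C>"
  shows "\<bar>\<Sum>\<phi>\<in>V \<rightarrow>\<^sub>E {1..n}. (A - B) (edge_tuple r \<phi> e) *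
      (\<Prod>e'\<in>E' - {e}. S e' (edge_tuple r \<phi> e'))\<bar>
    \<le> \<epsilon> * p * (hom_sum (E' - {e}) S +
      (\<Sum>f\<in>base (BB e). p ^ (edge_degree E e - edge_subdegree E e f) *
        hom_sum (face_edges E' e f) S))"
proof -
  have eE: "e \<in> E"
    using E' e by auto
  have sum_V: "(\<Sum>\<phi>\<in>V \<rightarrow>\<^sub>E {1..n}. g \<phi>)
      = (\<Sum>y\<in>V - e \<rightarrow>\<^sub>E {1..n}. \<Sum>x\<in>e \<rightarrow>\<^sub>E {1..n}. g (override_on y x e))"
    for g :: "('v \<Rightarrow> nat) \<Rightarrow> real"
  proof -
    have "(V - e) \<union> e = V" "(V - e) \<inter> e = {}"
      using edge_subset[OF eE] by auto
    then show ?thesis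
      using sum_PiE_Un[of "V - e" e g "{1..n}"] by (simp only:)
  qed
  have face: "(\<Sum>y\<in>V - e \<rightarrow>\<^sub>E {1..n}. real n ^ (r - card f) * (\<Sum>x\<in>f \<rightarrow>\<^sub>E {1..n}.
      \<Prod>e'\<in>face_edges E' e f. S e' (edge_tuple r (override_on y x f) e')))
      = hom_sum (face_edges E' e f) S" if f: "f \<in> base (BB e)" for f
  proof -
    have fe: "f \<subset> e" using base_subset[OF eE f] .
    define g where "g \<phi> = (\<Prod>e'\<in>face_edges E' e f. S e' (edge_tuple r \<phi> e'))" for \<phi>
    have "edge_tuple r (override_on w z (e - f)) e' = edge_tuple r w e'"
      if "e' \<in> face_edges E' e f" for w z e'
      using that E' by (intro edge_tuple_cong_E) (auto simp: face_edges_def override_on_def)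
    then have "g (override_on w z (e - f)) = g w" for w z
      unfolding g_def by simp
    then have "(\<Sum>\<phi>\<in>V \<rightarrow>\<^sub>E {1..n}. g \<phi>)
        = real (card {1..n}) ^ card (e - f) * (\<Sum>w\<in>V - (e - f) \<rightarrow>\<^sub>E {1..n}. g w)"
      using edge_subset[OF eE] by (intro sum_PiE_ignore finite_V) auto
    also have "card (e - f) = r - card f"
      using fe finite_edge[OF eE] card_edge[OF eE]
      by (metis card_Diff_subset finite_subset psubset_imp_subset)
    also have "V - (e - f) = (V - e) \<union> f"
      using fe edge_subset[OF eE] by auto
    also have "(\<Sum>w\<in>V - e \<union> f \<rightarrow>\<^sub>E {1..n}. g w)
        = (\<Sum>y\<in>V - e \<rightarrow>\<^sub>E {1..n}. \<Sum>x\<in>f \<rightarrow>\<^sub>E {1..n}. g (override_on y x f))"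
      using fe by (intro sum_PiE_Un) auto
    finally show ?thesis
      by (simp add: hom_sum_def g_def sum_distrib_left)
  qed
  have "\<bar>\<Sum>\<phi>\<in>V \<rightarrow>\<^sub>E {1..n}. (A - B) (edge_tuple r \<phi> e) *
      (\<Prod>e'\<in>E' - {e}. S e' (edge_tuple r \<phi> e'))\<bar>
    \<le> (\<Sum>y\<in>V - e \<rightarrow>\<^sub>E {1..n}. \<bar>\<Sum>x\<in>e \<rightarrow>\<^sub>E {1..n}.
        (A - B) (edge_tuple r (override_on y x e) e) *
        (\<Prod>e'\<in>E' - {e}. S e' (edge_tuple r (override_on y x e) e'))\<bar>)"
    unfolding sum_V by (rule sum_abs)
  also have "\<dots> \<le> (\<Sum>y\<in>V - e \<rightarrow>\<^sub>E {1..n}. \<epsilon> * p *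
      ((\<Sum>x\<in>e \<rightarrow>\<^sub>E {1..n}. \<Prod>e'\<in>E' - {e}. S e' (edge_tuple r (override_on y x e) e')) +
      (\<Sum>f\<in>base (BB e). real n ^ (r - card f) * p ^ (edge_degree E e - edge_subdegree E e f) *
        (\<Sum>x\<in>f \<rightarrow>\<^sub>E {1..n}. \<Prod>e'\<in>face_edges E' e f. S e' (edge_tuple r (override_on y x f) e')))))"
    by (intro sum_mono fiber_bound assms)
  also have "\<dots> = \<epsilon> * p * (hom_sum (E' - {e}) S +
      (\<Sum>f\<in>base (BB e). p ^ (edge_degree E e - edge_subdegree E e f) *
        (\<Sum>y\<in>V - e \<rightarrow>\<^sub>E {1..n}. real n ^ (r - card f) * (\<Sum>x\<in>f \<rightarrow>\<^sub>E {1..n}.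
          \<Prod>e'\<in>face_edges E' e f. S e' (edge_tuple r (override_on y x f) e')))))"
    unfolding hom_sum_def sum_V sum_distrib_left[symmetric] sum.distrib
    by (subst sum.swap) (simp add: sum_distrib_left mult_ac)
  also have "\<dots> = \<epsilon> * p * (hom_sum (E' - {e}) S +
      (\<Sum>f\<in>base (BB e). p ^ (edge_degree E e - edge_subdegree E e f) *
        hom_sum (face_edges E' e f) S))"
    by (simp only: face cong: sum.cong)
  finally show ?thesis .
qed

text \<open>The degree difference counts the edges \<open>e' \<noteq> e\<close> of \<open>E\<close> with \<open>e' \<inter> e\<close> not inside \<open>f\<close>, hence at
  least those of \<open>E'\<close>. So the weights of the full hypergraph serve for all its subgraphs.\<close>

lemma card_face_edges:
  assumes "E' \<subseteq> E" and "e \<in> E'" and f: "f \<in> base (BB e)"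
  shows "card E' \<le> edge_degree E e - edge_subdegree E e f + card (face_edges E' e f) + 1"
proof -
  have eE: "e \<in> E" using assms by auto
  have fe: "f \<subset> e" using base_subset[OF eE f] .
  let ?X = "{e' \<in> E. e' \<noteq> e \<and> e' \<inter> e \<noteq> {}}" and ?Y = "{e' \<in> E. e' \<inter> e \<noteq> {} \<and> e' \<inter> e \<subseteq> f}"
  have "?Y \<subseteq> ?X" using fe by auto
  then have "card (?X - ?Y) = edge_degree E e - edge_subdegree E e f"
    unfolding edge_degree_def edge_subdegree_def using finite_E by (intro card_Diff_subset) auto
  moreover have "E' \<subseteq> (?X - ?Y) \<union> face_edges E' e f \<union> {e}"
    using assms by (auto simp: face_edges_def)
  then have "card E' \<le> card ((?X - ?Y) \<union> face_edges E' e f \<union> {e})"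
    using finite_E finite_subset[OF assms(1) finite_E]
    by (intro card_mono) (auto simp: face_edges_def)
  moreover have "card ((?X - ?Y) \<union> face_edges E' e f \<union> {e})
      \<le> card (?X - ?Y) + card (face_edges E' e f) + card {e}"
    using card_Un_le[of "?X - ?Y" "face_edges E' e f"]
      card_Un_le[of "(?X - ?Y) \<union> face_edges E' e f" "{e}"] by linarith
  ultimately show ?thesis by simp
qed

text \<open>The powers of \<open>p\<close> have to balance. By \<open>card_face_edges\<close> the
  weight of a face and the normalisation of its subgraph together supply at least
  \<open>card E' - 1\<close> of them, and the diameter supplies the last. The constant counts one
  term for the 1-norm and at most \<open>2 ^ r\<close> faces.\<close>

lemma edge_change_density:
  assumes E': "E' \<subseteq> E" and e: "e \<in> E'" and S: "\<forall>e'\<in>E'. S e' \<in> \<C>"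
    and A: "A \<in> \<C>" and B: "B \<in> \<C>" and M: "M \<ge> 0"
    and sub: "\<And>E''. E'' \<subset> E' \<Longrightarrow> hom_density r n p V E'' S \<le> M"
  shows "\<bar>hom_density r n p V E' (S(e := A)) - hom_density r n p V E' (S(e := B))\<bar>
    \<le> \<epsilon> * (1 + 2 ^ r) * M"
proof -
  have eE: "e \<in> E" and finE': "finite E'"
    using E' e finite_E finite_subset by auto
  have card_pos: "card E' > 0"
    using finE' e card_gt_0_iff by blast
  define N where "N = real n ^ card V"
  have N: "N > 0" using n by (simp add: N_def)
  \<comment> \<open>Here \<open>k\<close> powers of \<open>p\<close> come from the weight and
    \<open>card E''\<close> from the normalisation. As \<open>p \<le> 1\<close>, an excess over
    \<open>card E' - 1\<close> only helps.\<close>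
  have hom_sum_le: "p ^ k * hom_sum E'' S \<le> N * p ^ (card E' - 1) * M"
    if E'': "E'' \<subset> E'" and k: "card E' \<le> k + card E'' + 1" for k E''
  proof -
    have "hom_sum E'' S = N * p ^ card E'' * hom_density r n p V E'' S"
      using N p by (simp add: hom_density_def hom_sum_def N_def)
    also have "\<dots> \<le> N * p ^ card E'' * M"
      using N p sub[OF E''] by (intro mult_left_mono) auto
    finally have "p ^ k * hom_sum E'' S \<le> p ^ k * (N * p ^ card E'' * M)"
      using p by (intro mult_left_mono) auto
    also have "\<dots> = N * p ^ (k + card E'') * M"
      by (simp add: power_add)
    also have "\<dots> \<le> N * p ^ (card E' - 1) * M"
      using N p M k by (intro mult_left_mono mult_right_mono power_decreasing) auto
    finally show ?thesis .
  qed
  have 1: "hom_sum (E' - {e}) S \<le> N * p ^ (card E' - 1) * M"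
  proof -
    have "E' - {e} \<subset> E'" "card E' \<le> 0 + card (E' - {e}) + 1"
      using e finE' by auto
    then show ?thesis
      using hom_sum_le[of "E' - {e}" 0] by simp
  qed
  have "(\<Sum>f\<in>base (BB e). p ^ (edge_degree E e - edge_subdegree E e f) *
        hom_sum (face_edges E' e f) S) \<le> (\<Sum>f\<in>base (BB e). N * p ^ (card E' - 1) * M)"
    using card_face_edges[OF E' e] e
    by (intro sum_mono hom_sum_le) (auto simp: face_edges_def)
  also have "\<dots> = real (card (base (BB e))) * (N * p ^ (card E' - 1) * M)"
    by simp
  also have "\<dots> \<le> 2 ^ r * (N * p ^ (card E' - 1) * M)"
    using of_nat_mono[OF card_base[OF eE], where ?'a = real] N p M
    by (intro mult_right_mono) auto
  finally have 2: "(\<Sum>f\<in>base (BB e). p ^ (edge_degree E e - edge_subdegree E e f) *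
        hom_sum (face_edges E' e f) S) \<le> 2 ^ r * (N * p ^ (card E' - 1) * M)" .
  have "\<bar>\<Sum>\<phi>\<in>V \<rightarrow>\<^sub>E {1..n}. (A - B) (edge_tuple r \<phi> e) *
      (\<Prod>e'\<in>E' - {e}. S e' (edge_tuple r \<phi> e'))\<bar>
    \<le> \<epsilon> * p * (N * p ^ (card E' - 1) * M + 2 ^ r * (N * p ^ (card E' - 1) * M))"
    using \<epsilon> p by (intro order_trans[OF edge_change_sum[OF E' e S A B]] mult_left_mono
        add_mono 1 2) auto
  also have "\<dots> = \<epsilon> * (1 + 2 ^ r) * M * (N * (p * p ^ (card E' - 1)))"
    by (simp add: algebra_simps)
  \<comment> \<open>The factor \<open>p\<close> from the diameter completes the power; the truncated
    subtraction is harmless since \<open>E'\<close> contains \<open>e\<close>.\<close>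
  also have "p * p ^ (card E' - 1) = p ^ card E'"
    using card_pos by (simp add: power_eq_if)
  finally have *: "\<bar>\<Sum>\<phi>\<in>V \<rightarrow>\<^sub>E {1..n}. (A - B) (edge_tuple r \<phi> e) *
      (\<Prod>e'\<in>E' - {e}. S e' (edge_tuple r \<phi> e'))\<bar> \<le> \<epsilon> * (1 + 2 ^ r) * M * (N * p ^ card E')" .
  have "hom_density r n p V E' (S(e := A)) - hom_density r n p V E' (S(e := B))
      = (\<Sum>\<phi>\<in>V \<rightarrow>\<^sub>E {1..n}. (A - B) (edge_tuple r \<phi> e) *
      (\<Prod>e'\<in>E' - {e}. S e' (edge_tuple r \<phi> e'))) / (N * p ^ card E')"
    unfolding hom_density_update[OF finE' e] N_def
    by (simp add: left_diff_distrib sum_subtractf diff_divide_distrib)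
  then show ?thesis
    using * N p by (simp add: abs_mult divide_le_eq)
qed

section \<open>Passage to the hull and induction over subgraphs\<close>

text \<open>The estimate is first proved for families in \<open>\<C>\<close>, whose values are 0 or
  1, and then carried to the hull. Hence on smaller subgraphs only families in \<open>\<C>\<close>
  have to be controlled.\<close>

lemma hull_density_change:
  assumes E': "E' \<subseteq> E" and M: "M \<ge> 0"
    and sub: "\<And>E'' S. E'' \<subset> E' \<Longrightarrow> \<forall>e\<in>E''. S e \<in> \<C> \<Longrightarrow> hom_density r n p V E'' S \<le> M"
    and P: "\<forall>e\<in>E'. P e \<in> convex hull \<C>" and Q: "\<forall>e\<in>E'. Q e \<in> convex hull \<C>"
  shows "\<bar>hom_density r n p V E' P - hom_density r n p V E' Q\<bar>
    \<le> real (card E) * (1 + 2 ^ r) * \<epsilon> * M" (is "_ \<le> ?b")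
proof -
  have finE': "finite E'"
    using E' finite_E finite_subset by auto
  have vertices: "\<bar>hom_density r n p V E' P - hom_density r n p V E' Q\<bar> \<le> ?b"
    if P: "\<forall>e\<in>E'. P e \<in> \<C>" and Q: "\<forall>e\<in>E'. Q e \<in> \<C>" for P Q
  proof -
    have "\<bar>hom_density r n p V E' P - hom_density r n p V E' Q\<bar>
        \<le> real (card E') * (\<epsilon> * (1 + 2 ^ r) * M)"
    proof (rule telescoping_bound[OF finE' hom_density_cong _ P Q])
      show "\<bar>hom_density r n p V E' (S(e := X)) - hom_density r n p V E' (S(e := Y))\<bar>
          \<le> \<epsilon> * (1 + 2 ^ r) * M"
        if "e \<in> E'" "\<forall>e\<in>E'. S e \<in> \<C>" "X \<in> \<C>" "Y \<in> \<C>" for S e X Y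
        using that by (intro edge_change_density E' M sub) auto
    qed
    also have "\<dots> \<le> real (card E) * (\<epsilon> * (1 + 2 ^ r) * M)"
      using card_mono[OF finite_E E'] \<epsilon> M by (intro mult_right_mono) auto
    finally show ?thesis
      by (simp add: mult_ac)
  qed
  have hull: "\<bar>hom_density r n p V E' S - c\<bar> \<le> ?b"
    if "\<And>S. \<forall>e\<in>E'. S e \<in> \<C> \<Longrightarrow> \<bar>hom_density r n p V E' S - c\<bar> \<le> ?b"
      and "\<forall>e\<in>E'. S e \<in> convex hull \<C>" for S c
    by (rule multiaffine_convex_hull_bound[OF finE' _ that]) (rule hom_density_affine[OF finE'])
  \<comment> \<open>First \<open>P\<close> moves to the hull while \<open>Q\<close> stays in
    \<open>\<C>\<close>; then \<open>Q\<close> moves, with the density of the hull-valued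
    \<open>P\<close> as centre.\<close>
  have "\<bar>hom_density r n p V E' P - hom_density r n p V E' Q\<bar> \<le> ?b"
    if "\<forall>e\<in>E'. Q e \<in> \<C>" for Q
    by (rule hull[OF vertices P]) (use that in auto)
  then have "\<bar>hom_density r n p V E' Q - hom_density r n p V E' P\<bar> \<le> ?b"
    by (intro hull[OF _ Q]) (simp add: abs_minus_commute)
  then show ?thesis
    by (simp add: abs_minus_commute)
qed

text \<open>Strong induction on the number of edges. \<open>S\<close> is compared with the constant
  family \<open>Q0\<close>, which may lie outside \<open>\<C>\<close>, so the hull version of the
  estimate is applied. Each edge costs a factor \<open>1 + a\<close>, hence the power.\<close>

lemma subgraph_density_bound:
  assumes \<epsilon>1: "\<epsilon> \<le> 1" and L: "L \<ge> 0" and Q0: "Q0 \<in> convex hull \<C>"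
    and bound: "\<And>E'. E' \<subset> E \<Longrightarrow> hom_density r n p V E' (\<lambda>_. Q0) \<le> L"
    and E': "E' \<subset> E" and S: "\<forall>e\<in>E'. S e \<in> \<C>"
  shows "hom_density r n p V E' S \<le> (1 + real (card E) * (1 + 2 ^ r)) ^ card E' * L"
  using E' S
proof (induction "card E'" arbitrary: E' S rule: less_induct)
  case less
  have finE': "finite E'"
    using less.prems finite_E finite_subset by auto
  define a where "a = real (card E) * (1 + 2 ^ r)"
  have a: "a \<ge> 0" by (simp add: a_def)
  show ?case
  proof (cases "E' = {}")
    case True
    \<comment> \<open>Without edges the density does not depend on the tensors, so the bound at
      \<open>Q0\<close> applies directly.\<close>
    have "hom_density r n p V {} S = hom_density r n p V {} (\<lambda>_. Q0)"
      by (rule hom_density_cong) auto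
    then show ?thesis
      using True bound[of E'] less.prems by simp
  next
    case False
    then obtain k where k: "card E' = Suc k"
      using finE' by (cases "card E'") auto
    have "hom_density r n p V E'' S' \<le> (1 + a) ^ k * L"
      if E'': "E'' \<subset> E'" and S': "\<forall>e\<in>E''. S' e \<in> \<C>" for E'' S'
    proof -
      have lt: "card E'' < card E'"
        using E'' finE' by (rule psubset_card_mono[rotated])
      then have "hom_density r n p V E'' S' \<le> (1 + a) ^ card E'' * L"
        unfolding a_def using E'' S' less.prems by (intro less.hyps) auto
      also have "\<dots> \<le> (1 + a) ^ k * L"
        using lt k a L by (intro mult_right_mono power_increasing) auto
      finally show ?thesis .
    qed
    then have "\<bar>hom_density r n p V E' S - hom_density r n p V E' (\<lambda>_. Q0)\<bar>
        \<le> real (card E) * (1 + 2 ^ r) * \<epsilon> * ((1 + a) ^ k * L)"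
      using less.prems Q0 a L hull_subset[of \<C> convex] by (intro hull_density_change) auto
    also have "\<dots> = \<epsilon> * (a * ((1 + a) ^ k * L))"
      by (simp add: a_def)
    \<comment> \<open>Here \<open>\<epsilon> \<le> 1\<close> keeps the growth factor independent of
      \<open>\<epsilon>\<close>.\<close>
    also have "\<dots> \<le> 1 * (a * ((1 + a) ^ k * L))"
      using \<epsilon>1 a L by (intro mult_right_mono) auto
    finally have "hom_density r n p V E' S \<le> L + a * ((1 + a) ^ k * L)"
      using bound[OF less.prems(1)] by linarith
    \<comment> \<open>Raising the first \<open>L\<close> to \<open>(1 + a) ^ k * L\<close> closes
      the recursion with ratio \<open>1 + a\<close>.\<close>
    also have "\<dots> \<le> (1 + a) ^ k * L + a * ((1 + a) ^ k * L)"
      using a L one_le_power[of "1 + a" k] mult_right_mono[of 1 "(1 + a) ^ k" L] by simp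
    also have "\<dots> = (1 + a) ^ card E' * L"
      by (simp add: k algebra_simps)
    finally show ?thesis
      by (simp add: a_def)
  qed
qed

end

theorem theorem2p15:
  fixes r :: nat and V :: "'v set" and E :: "'v set set"
  assumes "r \<ge> 2" and "uniform_hypergraph r V E"
  shows "\<exists>C::real.
    \<forall>(p::real) (n::nat) (BB :: 'v set \<Rightarrow> 'v weighted_base) (\<C> :: tensor set)
      (\<epsilon>::real) (Q0::tensor) (L::real) (P :: 'v set \<Rightarrow> tensor) (Q :: 'v set \<Rightarrow> tensor).
      0 < p \<and> p < 1 \<and> n \<ge> 1 \<and>
      is_base_system r E BB \<and> dominating E BB \<and>
      (\<forall>e\<in>E. topdeg (BB e) = edge_degree E e \<and>
              (\<forall>f\<in>base (BB e). subdeg (BB e) f = edge_subdegree E e f)) \<and>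
      \<C> \<subseteq> adjacency_tensors n r \<and>
      0 < \<epsilon> \<and> \<epsilon> \<le> 1 \<and>
      (\<forall>A\<in>\<C>. \<forall>B\<in>\<C>. system_norm n p E BB (A - B) \<le> \<epsilon> * p) \<and>
      Q0 \<in> convex hull \<C> \<and> L \<ge> 1 \<and>
      (\<forall>V' E'. proper_subgraph r V' E' V E \<longrightarrow> hom_density r n p V' E' (\<lambda>_. Q0) \<le> L) \<and>
      (\<forall>e\<in>E. P e \<in> convex hull \<C> \<and> Q e \<in> convex hull \<C>)
      \<longrightarrow> \<bar>hom_density r n p V E P - hom_density r n p V E Q\<bar> \<le> C * L * \<epsilon>"
proof (intro exI allI impI, elim conjE)
  let ?a = "real (card E) * (1 + 2 ^ r)"
  fix p :: real and n :: nat and BB :: "'v set \<Rightarrow> 'v weighted_base" and \<C> :: "tensor set"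
    and \<epsilon> :: real and Q0 :: tensor and L :: real and P Q :: "'v set \<Rightarrow> tensor"
  assume p: "0 < p" "p < 1" and n: "n \<ge> 1" and sys: "is_base_system r E BB" "dominating E BB"
    and deg: "\<forall>e\<in>E. topdeg (BB e) = edge_degree E e \<and>
              (\<forall>f\<in>base (BB e). subdeg (BB e) f = edge_subdegree E e f)"
    and \<C>: "\<C> \<subseteq> adjacency_tensors n r" and eps: "0 < \<epsilon>" "\<epsilon> \<le> 1"
    and diam: "\<forall>A\<in>\<C>. \<forall>B\<in>\<C>. system_norm n p E BB (A - B) \<le> \<epsilon> * p"
    and Q0: "Q0 \<in> convex hull \<C>" and L: "L \<ge> 1"
    and sub: "\<forall>V' E'. proper_subgraph r V' E' V E \<longrightarrow> hom_density r n p V' E' (\<lambda>_. Q0) \<le> L"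
    and PQ: "\<forall>e\<in>E. P e \<in> convex hull \<C> \<and> Q e \<in> convex hull \<C>"
  interpret dominated_tensors r V E p n BB \<C> \<epsilon>
    using assms p n sys deg \<C> eps diam by unfold_locales auto
  have "hom_density r n p V E' (\<lambda>_. Q0) \<le> L" if "E' \<subset> E" for E'
  proof -
    \<comment> \<open>A proper subgraph may keep all vertices; only its edge set has to be strictly
      smaller.\<close>
    have "proper_subgraph r V E' V E"
      using assms(2) that unfolding proper_subgraph_def uniform_hypergraph_def by blast
    then show ?thesis
      using sub by blast
  qed
  note sub' = subgraph_density_bound[OF eps(2) _ Q0 this]
  have "hom_density r n p V E' S \<le> (1 + ?a) ^ card E * L"
    if "E' \<subset> E" and "\<forall>e\<in>E'. S e \<in> \<C>" for E' S
  proof -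
    have "hom_density r n p V E' S \<le> (1 + ?a) ^ card E' * L"
      using sub' that L by auto
    also have "\<dots> \<le> (1 + ?a) ^ card E * L"
      using L psubset_card_mono[OF finite_E that(1)]
      by (intro mult_right_mono power_increasing) auto
    finally show ?thesis .
  qed
  \<comment> \<open>A last application, now to \<open>E\<close> itself, contributes the factor
    \<open>?a * \<epsilon>\<close>. The resulting constant depends only on \<open>card E\<close> and
    \<open>r\<close>.\<close>
  then have "\<bar>hom_density r n p V E P - hom_density r n p V E Q\<bar>
      \<le> ?a * \<epsilon> * ((1 + ?a) ^ card E * L)"
    using PQ L by (intro hull_density_change) auto
  then show "\<bar>hom_density r n p V E P - hom_density r n p V E Q\<bar>
      \<le> (?a * (1 + ?a) ^ card E) * L * \<epsilon>"
    by (simp add: mult_ac)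
qed

end
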